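(* Let $\alpha_1,\alpha_2,\beta_1,\beta_2>0$ and let $(u,v)$ be a nonnegative classical solution of the Robin problem $$\begin{cases}\Delta[(d_1+a_{11}u)u]+u(1-u-a_1v)=0, & x\in\Omega,\\ \Delta[(d_2+a_{22}v)v]+v(1-a_2u-v)=0, & x\in\Omega,\\ \alpha_1u+\beta_1\dfrac{\partial u}{\partial\nu}=\alpha_2v+\beta_2\dfrac{\partial v}{\partial\nu}=0, & x\in\partial\Omega.\end{cases}$$ If $u\not\equiv0$, then $u\le1$ in $\overline\Omega$. Similarly, if $v\not\equiv0$, then $v\le1$ in $\overline\Omega$.
   Context: $\Omega\subset\mathbb{R}^n$ ($n\ge1$) is a bounded domain with smooth boundary satisfying the interior ball condition at every boundary point, and $\nu$ is the outward unit normal on $\partial\Omega$. The constants satisfy $a_1,a_2,d_1,d_2>0$ and $a_{11},a_{22}\ge0$. A nonnegative classical solution is a pair $(u,v)\in (C^1(\overline\Omega)\cap C^2(\Omega))^2$ with $u,v\ge0$ in $\overline\Omega$ satisfying the system (equations and boundary conditions) pointwise. *)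

theory Defs
  imports "HOL-Analysis.Analysis"
begin

definition partial_deriv :: "'n::finite \<Rightarrow> (real^'n \<Rightarrow> real) \<Rightarrow> real^'n \<Rightarrow> real" where
  "partial_deriv i f x = frechet_derivative f (at x) (axis i 1)"

definition laplacian :: "(real^'n::finite \<Rightarrow> real) \<Rightarrow> real^'n \<Rightarrow> real" where
  "laplacian f x = (\<Sum>i\<in>UNIV. partial_deriv i (partial_deriv i f) x)"

text \<open>The space of \<open>k\<close> times continuously differentiable functions on an open set \<open>S\<close>.
  Differentiability at each stage is required explicitly, because \<open>frechet_derivative\<close>
  is an arbitrary value where the derivative does not exist.\<close>

primrec Ck_on :: "nat \<Rightarrow> (real^'n::finite) set \<Rightarrow> (real^'n \<Rightarrow> real) \<Rightarrow> bool" where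
  "Ck_on 0 S f \<longleftrightarrow> continuous_on S f"
| "Ck_on (Suc k) S f \<longleftrightarrow>
     (\<forall>x\<in>S. f differentiable (at x)) \<and> (\<forall>i. Ck_on k S (partial_deriv i f))"

definition smooth_on :: "(real^'n::finite) set \<Rightarrow> (real^'n \<Rightarrow> real) \<Rightarrow> bool" where
  "smooth_on S f \<longleftrightarrow> (\<forall>k. Ck_on k S f)"

text \<open>The space \<open>C\<^sup>1\<close> of the closure of an open set \<open>S\<close>: the function is \<open>C\<^sup>1\<close> in \<open>S\<close>, and
  it and all its first partial derivatives extend continuously to the closure (the values of
  \<open>f\<close> on the frontier being those of its extension).\<close>

definition C1_closure :: "(real^'n::finite) set \<Rightarrow> (real^'n \<Rightarrow> real) \<Rightarrow> bool" where
  "C1_closure S f \<longleftrightarrow> Ck_on 1 S f \<and> continuous_on (closure S) f \<and>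
     (\<forall>i. \<exists>g. continuous_on (closure S) g \<and> (\<forall>x\<in>S. g x = partial_deriv i f x))"

text \<open>For \<open>f\<close> in \<open>C1_closure S\<close> and \<open>x\<close> in the frontier of the open set \<open>S\<close>, the limit below is the
  value at \<open>x\<close> of the continuous extension of the gradient. It does not depend on values of
  \<open>f\<close> outside the closure of \<open>S\<close>.\<close>

definition bdry_grad :: "(real^'n::finite) set \<Rightarrow> (real^'n \<Rightarrow> real) \<Rightarrow> real^'n \<Rightarrow> real^'n" where
  "bdry_grad S f x = (\<chi> i. Lim (at x within S) (partial_deriv i f))"

definition normal_deriv ::
    "(real^'n::finite) set \<Rightarrow> (real^'n \<Rightarrow> real^'n) \<Rightarrow> (real^'n \<Rightarrow> real) \<Rightarrow> real^'n \<Rightarrow> real" where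
  "normal_deriv S \<nu> f x = bdry_grad S f x \<bullet> \<nu> x"

text \<open>Near the point \<open>x\<^sub>0\<close>, the set \<open>S\<close> is the region strictly on one side of the graph of a smooth
  function of the other \<open>n - 1\<close> coordinates. The choice of coordinate \<open>i\<close> and of sign \<open>s\<close>
  stands for the usual ``after relabelling and reorienting the coordinate axes''.
  A function of the coordinates other than \<open>i\<close> is encoded as a function on the whole space that
  is constant in direction \<open>axis i 1\<close>.\<close>

definition graph_chart ::
    "(real^'n::finite) set \<Rightarrow> real^'n \<Rightarrow> 'n \<Rightarrow> real \<Rightarrow> (real^'n \<Rightarrow> real) \<Rightarrow> bool" where
  "graph_chart S x\<^sub>0 i s \<gamma> \<longleftrightarrow>
     s \<in> {1, -1} \<and> smooth_on UNIV \<gamma> \<and> (\<forall>x t. \<gamma> (x + t *\<^sub>R axis i 1) = \<gamma> x) \<and>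
     (\<exists>r>0. S \<inter> ball x\<^sub>0 r = {x \<in> ball x\<^sub>0 r. \<gamma> x < s * x $ i})"

definition smooth_boundary :: "(real^'n::finite) set \<Rightarrow> bool" where
  "smooth_boundary S \<longleftrightarrow> (\<forall>x\<^sub>0\<in>frontier S. \<exists>i s \<gamma>. graph_chart S x\<^sub>0 i s \<gamma>)"

text \<open>In a chart, \<open>S\<close> is locally the sublevel set \<open>\<gamma> x - s * x $ i < 0\<close>, so the outward
  normal is the normalised gradient of \<open>\<gamma> x - s * x $ i\<close>. The gradient does not vanish, as its
  \<open>i\<close>-th component is \<open>- s\<close>; the resulting unit vector does not depend on the chart.\<close>

definition outward_unit_normal :: "(real^'n::finite) set \<Rightarrow> real^'n \<Rightarrow> real^'n \<Rightarrow> bool" where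
  "outward_unit_normal S x\<^sub>0 w \<longleftrightarrow>
     (\<exists>i s \<gamma>. graph_chart S x\<^sub>0 i s \<gamma> \<and>
        w = sgn ((\<chi> j. partial_deriv j \<gamma> x\<^sub>0) - s *\<^sub>R axis i 1))"

definition interior_ball_condition :: "(real^'n::finite) set \<Rightarrow> bool" where
  "interior_ball_condition S \<longleftrightarrow>
     (\<forall>x\<in>frontier S. \<exists>y r. 0 < r \<and> ball y r \<subseteq> S \<and> x \<in> sphere y r)"

definition nonneg_classical_solution ::
    "(real^'n::finite) set \<Rightarrow> (real^'n \<Rightarrow> real^'n) \<Rightarrow>
     real \<Rightarrow> real \<Rightarrow> real \<Rightarrow> real \<Rightarrow> real \<Rightarrow> real \<Rightarrow> real \<Rightarrow> real \<Rightarrow> real \<Rightarrow> real \<Rightarrow>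
     (real^'n \<Rightarrow> real) \<Rightarrow> (real^'n \<Rightarrow> real) \<Rightarrow> bool" where
  "nonneg_classical_solution \<Omega> \<nu>
     d\<^sub>1 a\<^sub>1\<^sub>1 a\<^sub>1 d\<^sub>2 a\<^sub>2\<^sub>2 a\<^sub>2 \<alpha>\<^sub>1 \<beta>\<^sub>1 \<alpha>\<^sub>2 \<beta>\<^sub>2 u v \<longleftrightarrow>
     C1_closure \<Omega> u \<and> Ck_on 2 \<Omega> u \<and> C1_closure \<Omega> v \<and> Ck_on 2 \<Omega> v \<and>
     (\<forall>x\<in>closure \<Omega>. 0 \<le> u x \<and> 0 \<le> v x) \<and>
     (\<forall>x\<in>\<Omega>. laplacian (\<lambda>y. (d\<^sub>1 + a\<^sub>1\<^sub>1 * u y) * u y) x + u x * (1 - u x - a\<^sub>1 * v x) = 0) \<and>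
     (\<forall>x\<in>\<Omega>. laplacian (\<lambda>y. (d\<^sub>2 + a\<^sub>2\<^sub>2 * v y) * v y) x + v x * (1 - a\<^sub>2 * u x - v x) = 0) \<and>
     (\<forall>x\<in>frontier \<Omega>. \<alpha>\<^sub>1 * u x + \<beta>\<^sub>1 * normal_deriv \<Omega> \<nu> u x = 0) \<and>
     (\<forall>x\<in>frontier \<Omega>. \<alpha>\<^sub>2 * v x + \<beta>\<^sub>2 * normal_deriv \<Omega> \<nu> v x = 0)"

end

theory Submission
  imports Defs
begin

text \<open>If \<open>u\<close> had a maximum \<open>M > 1\<close> over the closure, it could not lie in the interior:
  there the Laplacian of \<open>(d + a u) u\<close> is \<open>d + 2 a M\<close> times that of \<open>u\<close>, because the gradient
  of \<open>u\<close> vanishes, so it is nonpositive, while the reaction term is negative. Nor could it lie on the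
  boundary: the outward normal derivative is nonnegative at a boundary maximum, while the Robin
  condition makes it \<open>- \<alpha> M / \<beta> < 0\<close>. The strong maximum principle and Hopf's lemma are not
  needed, because the Robin condition already gives a strict sign.\<close>

section \<open>Directional derivatives as derivatives along lines\<close>

lemma frechet_derivative_eq_sum_partial_deriv:
  fixes f :: "real^'n::finite \<Rightarrow> real"
  assumes "f differentiable (at x)"
  shows "frechet_derivative f (at x) h = (\<Sum>j\<in>UNIV. h $ j * partial_deriv j f x)"
proof -
  have lin: "linear (frechet_derivative f (at x))"
    using assms by (rule linear_frechet_derivative)
  have "frechet_derivative f (at x) h = frechet_derivative f (at x) (\<Sum>j\<in>UNIV. (h $ j) *\<^sub>R axis j 1)"
    using basis_expansion[of h] unfolding scalar_mult_eq_scaleR by simp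
  then show ?thesis
    by (simp add: linear_sum[OF lin] linear_scale[OF lin] partial_deriv_def)
qed

lemma has_real_derivative_along_line:
  fixes f :: "real^'n::finite \<Rightarrow> real"
  assumes "f differentiable (at (x + t *\<^sub>R h))"
  shows "((\<lambda>t. f (x + t *\<^sub>R h)) has_real_derivative
      (\<Sum>j\<in>UNIV. h $ j * partial_deriv j f (x + t *\<^sub>R h))) (at t)"
proof -
  let ?F = "frechet_derivative f (at (x + t *\<^sub>R h))"
  have f: "(f has_derivative ?F) (at (x + t *\<^sub>R h))"
    using assms frechet_derivative_works by blast
  have "((\<lambda>t. x + t *\<^sub>R h) has_derivative (\<lambda>t. t *\<^sub>R h)) (at t)"
    by (auto intro!: derivative_eq_intros)
  from diff_chain_at[OF this f]
  have "((\<lambda>t. f (x + t *\<^sub>R h)) has_derivative (\<lambda>s. ?F (s *\<^sub>R h))) (at t)"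
    by (simp add: o_def)
  moreover have "?F (s *\<^sub>R h) = (\<Sum>j\<in>UNIV. h $ j * partial_deriv j f (x + t *\<^sub>R h)) * s" for s
    by (simp add: frechet_derivative_eq_sum_partial_deriv[OF assms] sum_distrib_left mult_ac)
  ultimately show ?thesis
    by (simp add: has_field_derivative_def)
qed

lemma has_real_derivative_along_axis:
  fixes f :: "real^'n::finite \<Rightarrow> real"
  assumes "f differentiable (at (x + t *\<^sub>R axis i 1))"
  shows "((\<lambda>t. f (x + t *\<^sub>R axis i 1)) has_real_derivative
      partial_deriv i f (x + t *\<^sub>R axis i 1)) (at t)"
proof -
  have "(\<Sum>j\<in>UNIV. axis i 1 $ j * c j) = c i" for c :: "'n \<Rightarrow> real"
    using inner_axis'[of i 1 "\<chi> j. c j"] by (simp add: inner_vec_def)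
  then show ?thesis
    using has_real_derivative_along_line[OF assms] by simp
qed

section \<open>First and second order conditions at an interior maximum\<close>

lemma partial_deriv_eq_0_at_max:
  fixes f :: "real^'n::finite \<Rightarrow> real"
  assumes "open S" "x \<in> S" "f differentiable (at x)" "\<And>y. y \<in> S \<Longrightarrow> f y \<le> f x"
  shows "partial_deriv i f x = 0"
proof -
  have "(f has_derivative frechet_derivative f (at x)) (at x)"
    using assms(3) by (simp add: frechet_derivative_works)
  from differential_zero_maxmin[OF assms(2,1) this] assms(4)
  show ?thesis by (simp add: partial_deriv_def)
qed

text \<open>The first partial derivative vanishes at the maximum. If its own derivative there were
  positive, it would be positive just beyond \<open>x\<close> on the coordinate line, and
  \<open>f\<close> would rise above its maximum.\<close>

lemma second_partial_deriv_nonpos_at_max: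
  fixes f :: "real^'n::finite \<Rightarrow> real"
  assumes "open S" "x \<in> S" and diff: "\<And>y. y \<in> S \<Longrightarrow> f differentiable (at y)"
    and diff2: "partial_deriv i f differentiable (at x)"
    and max: "\<And>y. y \<in> S \<Longrightarrow> f y \<le> f x"
  shows "partial_deriv i (partial_deriv i f) x \<le> 0"
proof (rule ccontr)
  let ?l = "\<lambda>t. x + t *\<^sub>R axis i (1::real)"
  assume "\<not> ?thesis"
  then have pos: "0 < partial_deriv i (partial_deriv i f) x" by simp
  obtain e where e: "e > 0" "ball x e \<subseteq> S"
    using assms(1,2) open_contains_ball by blast
  have inS: "?l t \<in> S" if "\<bar>t\<bar> < e" for t
    using that e(2) by (auto simp: dist_norm)
  have "((\<lambda>t. partial_deriv i f (?l t)) has_real_derivative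
      partial_deriv i (partial_deriv i f) x) (at 0)"
    using has_real_derivative_along_axis[of "partial_deriv i f" x 0 i] diff2 by simp
  from DERIV_pos_inc_right[OF this pos]
  obtain d where d: "d > 0" "\<And>t. 0 < t \<Longrightarrow> t < d \<Longrightarrow> partial_deriv i f x < partial_deriv i f (?l t)"
    by auto
  have zero: "partial_deriv i f x = 0"
    using partial_deriv_eq_0_at_max assms(1,2) diff max by blast
  \<comment> \<open>Staying below \<open>d\<close> keeps the slope positive on the open interval up
    to \<open>b\<close>; staying below \<open>e\<close> keeps the segment inside
    \<open>S\<close>.\<close>
  define b where "b = min d e / 2"
  have b: "0 < b" "b < d" "b < e" using d e by (auto simp: b_def min_def)
  have der: "((\<lambda>t. f (?l t)) has_real_derivative partial_deriv i f (?l t)) (at t)"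
    if "\<bar>t\<bar> < e" for t
    using that by (intro has_real_derivative_along_axis diff inS)
  have "f (?l 0) < f (?l b)"
  proof (rule DERIV_pos_imp_increasing_open[OF b(1)])
    fix t assume t: "0 < t" "t < b"
    then show "\<exists>y. ((\<lambda>t. f (?l t)) has_real_derivative y) (at t) \<and> 0 < y"
      using der[of t] d(2)[of t] zero b by fastforce
  next
    show "continuous_on {0..b} (\<lambda>t. f (?l t))"
      using b by (intro continuous_at_imp_continuous_on ballI DERIV_isCont[OF der]) auto
  qed
  with max[OF inS[of b]] b show False by simp
qed

section \<open>Boundary charts and the outward normal\<close>

text \<open>The opposite strict inequality would persist near \<open>x\<close> by continuity. But
  \<open>S\<close> has points arbitrarily close to \<open>x\<close>, and in the chart ball they
  satisfy \<open>\<gamma> y < s * y $ i\<close>.\<close>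

lemma graph_chart_frontier_le:
  fixes S :: "(real^'n::finite) set"
  assumes "x \<in> frontier S" "graph_chart S x i s \<gamma>"
  shows "\<gamma> x \<le> s * x $ i"
proof (rule ccontr)
  assume "\<not> ?thesis"
  then have pos: "0 < \<gamma> x - s * x $ i" by simp
  obtain r where r: "r > 0" "S \<inter> ball x r = {y \<in> ball x r. \<gamma> y < s * y $ i}"
    using assms(2) by (auto simp: graph_chart_def)
  have "Ck_on 0 UNIV \<gamma>"
    using assms(2) unfolding graph_chart_def smooth_on_def by blast
  then have "isCont \<gamma> x"
    by (simp add: continuous_on_eq_continuous_at)
  then have "isCont (\<lambda>y. \<gamma> y - s * y $ i) x"
    by (intro continuous_intros)
  \<comment> \<open>The filter \<open>nhds x\<close> includes \<open>x\<close> itself. As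
    \<open>S\<close> is not assumed open here, the nearby point of \<open>S\<close> chosen below
    could be \<open>x\<close>.\<close>
  then have "((\<lambda>y. \<gamma> y - s * y $ i) \<longlongrightarrow> \<gamma> x - s * x $ i) (nhds x)"
    using tendsto_at_iff_tendsto_nhds[of "\<lambda>y. \<gamma> y - s * y $ i" x] by (simp add: isCont_def)
  then have "eventually (\<lambda>y. 0 < \<gamma> y - s * y $ i) (nhds x)"
    using pos by (rule order_tendstoD)
  then obtain d where d: "d > 0" "\<And>y. dist y x < d \<Longrightarrow> 0 < \<gamma> y - s * y $ i"
    unfolding eventually_nhds_metric by blast
  have "x \<in> closure S" using assms(1) by (simp add: frontier_def)
  then obtain y where y: "y \<in> S" "dist y x < min d r"
    using d r closure_approachable by (metis min_less_iff_conj)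
  then have "y \<in> S \<inter> ball x r" by (simp add: dist_commute)
  then have "\<gamma> y < s * y $ i" unfolding r(2) by simp
  with d(2)[of y] y show False by simp
qed

text \<open>\<open>S\<close> is locally the set where \<open>\<gamma> y - s * y $ i\<close> is
  negative. This function is at most 0 at \<open>x\<close> and has gradient \<open>N\<close> there.
  Since \<open>w\<close> is \<open>N\<close> normalised, moving along \<open>- w\<close> decreases
  it at the initial rate \<open>norm N\<close>, so the segment enters \<open>S\<close> at
  once.\<close>

lemma outward_unit_normal_inward_segment:
  fixes S :: "(real^'n::finite) set"
  assumes "x \<in> frontier S" "outward_unit_normal S x w"
  shows "\<exists>e>0. \<forall>t. 0 < t \<and> t < e \<longrightarrow> x + t *\<^sub>R (- w) \<in> S"
proof -
  obtain i s \<gamma> where chart: "graph_chart S x i s \<gamma>"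
    and w: "w = sgn ((\<chi> j. partial_deriv j \<gamma> x) - s *\<^sub>R axis i 1)"
    using assms(2) unfolding outward_unit_normal_def by blast
  define N where "N = (\<chi> j. partial_deriv j \<gamma> x) - s *\<^sub>R axis i 1"
  obtain r where r: "r > 0" "S \<inter> ball x r = {y \<in> ball x r. \<gamma> y < s * y $ i}"
    using chart by (auto simp: graph_chart_def)
  have "Ck_on (Suc 0) UNIV \<gamma>"
    using chart unfolding graph_chart_def smooth_on_def by blast
  then have diff: "\<gamma> differentiable (at x)" by simp
  \<comment> \<open>\<open>\<gamma>\<close> is constant in direction \<open>i\<close>, so the
    \<open>i\<close>-th component of \<open>N\<close> is exactly \<open>- s\<close>; this is why
    \<open>N\<close> is nonzero and \<open>sgn\<close> gives a true unit vector.\<close>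
  have "partial_deriv i \<gamma> x = 0"
  proof -
    have "((\<lambda>t::real. \<gamma> x) has_real_derivative partial_deriv i \<gamma> x) (at 0)"
      using has_real_derivative_along_axis[of \<gamma> x 0 i] diff chart by (simp add: graph_chart_def)
    then show ?thesis by (metis DERIV_const DERIV_unique)
  qed
  then have "N $ i = - s" by (simp add: N_def axis_def)
  moreover have "s \<noteq> 0" using chart by (auto simp: graph_chart_def)
  ultimately have "N \<noteq> 0" by force
  have Nw: "N \<bullet> w = norm N"
    using \<open>N \<noteq> 0\<close> by (simp add: w N_def[symmetric] sgn_div_norm dot_square_norm power2_eq_square)
  have nw: "norm w = 1"
    using \<open>N \<noteq> 0\<close> by (simp add: w N_def[symmetric] norm_sgn)
  let ?h = "\<lambda>t. \<gamma> (x + t *\<^sub>R (- w)) - s * (x + t *\<^sub>R (- w)) $ i"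
  have "(?h has_real_derivative (\<Sum>j\<in>UNIV. (- w) $ j * partial_deriv j \<gamma> x) + s * w $ i) (at 0)"
    using has_real_derivative_along_line[of \<gamma> x 0 "- w"] diff
    by (auto intro!: derivative_eq_intros)
  moreover have "(\<Sum>j\<in>UNIV. (- w) $ j * partial_deriv j \<gamma> x) + s * w $ i = - (N \<bullet> w)"
  proof -
    have "N \<bullet> w = (\<chi> j. partial_deriv j \<gamma> x) \<bullet> w - s * w $ i"
      by (simp add: N_def inner_diff_left inner_axis' )
    then show ?thesis by (simp add: inner_vec_def sum_negf mult.commute)
  qed
  ultimately have "(?h has_real_derivative - norm N) (at 0)" by (simp add: Nw)
  from DERIV_neg_dec_right[OF this]
  obtain d where d: "d > 0" "\<And>t. 0 < t \<Longrightarrow> t < d \<Longrightarrow> ?h t < ?h 0"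
    using \<open>N \<noteq> 0\<close> by auto
  \<comment> \<open>As \<open>w\<close> has norm 1, \<open>t < r\<close> keeps the point in the
    chart ball, while \<open>t < d\<close> makes the defining function negative.\<close>
  have "x + t *\<^sub>R (- w) \<in> S" if t: "0 < t" "t < min d r" for t
  proof -
    have "?h t < 0"
      using d(2)[of t] t graph_chart_frontier_le[OF assms(1) chart] by simp
    moreover have "x + t *\<^sub>R (- w) \<in> ball x r"
      using t nw by (simp add: dist_norm)
    ultimately have "x + t *\<^sub>R (- w) \<in> S \<inter> ball x r" unfolding r(2) by simp
    then show ?thesis by blast
  qed
  then show ?thesis using d(1) r(1) by (intro exI[of _ "min d r"]) auto
qed

section \<open>The normal derivative at a boundary maximum\<close>

text \<open>\<open>Lim\<close> in \<open>bdry_grad\<close> is meaningful only if the limit exists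
  and is unique. The continuous extension supplies existence; uniqueness holds because a frontier
  point of an open set lies outside it and is therefore a limit point of it.\<close>

lemma tendsto_partial_deriv_bdry_grad:
  fixes S :: "(real^'n::finite) set"
  assumes "open S" "x \<in> frontier S" "C1_closure S f"
  shows "(partial_deriv i f \<longlongrightarrow> bdry_grad S f x $ i) (at x within S)"
proof -
  obtain g where g: "continuous_on (closure S) g" "\<And>y. y \<in> S \<Longrightarrow> g y = partial_deriv i f y"
    using assms(3) unfolding C1_closure_def by blast
  have x: "x \<in> closure S" "x \<notin> S"
    using assms(1,2) by (auto simp: frontier_def interior_open)
  then have "at x within S \<noteq> bot"
    by (simp add: trivial_limit_within islimpt_in_closure)
  moreover have "(g \<longlongrightarrow> g x) (at x within S)"
    using g(1) x(1) closure_subset[of S] tendsto_within_subset unfolding continuous_on_def by blast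
  then have lim: "(partial_deriv i f \<longlongrightarrow> g x) (at x within S)"
    by (rule Lim_transform_eventually) (auto simp: eventually_at_filter g(2))
  ultimately show ?thesis
    by (simp add: bdry_grad_def tendsto_Lim)
qed

text \<open>Along the segment going inward from \<open>x\<close>, the derivative of \<open>f\<close>
  tends to minus the normal derivative. Were the latter negative, \<open>f\<close> would increase
  strictly when leaving its maximum.\<close>

lemma normal_deriv_nonneg_at_max:
  fixes S :: "(real^'n::finite) set"
  assumes "open S" and x: "x \<in> frontier S" and normal: "outward_unit_normal S x (\<nu> x)"
    and C1: "C1_closure S f" and max: "\<And>y. y \<in> closure S \<Longrightarrow> f y \<le> f x"
  shows "0 \<le> normal_deriv S \<nu> f x"
proof (rule ccontr)
  assume neg: "\<not> ?thesis"
  let ?w = "- \<nu> x"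
  let ?l = "\<lambda>t. x + t *\<^sub>R ?w"
  let ?D = "\<lambda>y. \<Sum>j\<in>UNIV. ?w $ j * partial_deriv j f y"
  have diff: "f differentiable (at y)" if "y \<in> S" for y
    using C1 that by (simp add: C1_closure_def)
  have cont: "continuous_on (closure S) f"
    using C1 by (simp add: C1_closure_def)
  have xS: "x \<in> closure S" "x \<notin> S"
    using \<open>open S\<close> x by (auto simp: frontier_def interior_open)
  obtain e where e: "e > 0" "\<And>t. 0 < t \<Longrightarrow> t < e \<Longrightarrow> ?l t \<in> S"
    using outward_unit_normal_inward_segment[OF x normal] by blast
  have "filterlim ?l (at x within S) (at_right 0)"
    unfolding filterlim_at
  proof
    show "\<forall>\<^sub>F t in at_right 0. ?l t \<in> S \<and> ?l t \<noteq> x"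
      using e xS(2) unfolding eventually_at_right_field by metis
    have "(?l \<longlongrightarrow> x + 0 *\<^sub>R ?w) (at_right 0)"
      by (intro tendsto_intros)
    then show "(?l \<longlongrightarrow> x) (at_right 0)" by simp
  qed
  moreover have "(?D \<longlongrightarrow> - normal_deriv S \<nu> f x) (at x within S)"
  proof -
    have "(?D \<longlongrightarrow> (\<Sum>j\<in>UNIV. ?w $ j * bdry_grad S f x $ j)) (at x within S)"
      by (intro tendsto_intros tendsto_partial_deriv_bdry_grad assms)
    then show ?thesis
      by (simp add: normal_deriv_def inner_vec_def sum_negf mult.commute)
  qed
  ultimately have "((\<lambda>t. ?D (?l t)) \<longlongrightarrow> - normal_deriv S \<nu> f x) (at_right 0)"
    by (rule filterlim_compose[rotated])
  from order_tendstoD(1)[OF this, of 0] neg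
  obtain d where d: "d > 0" "\<And>t. 0 < t \<Longrightarrow> t < d \<Longrightarrow> 0 < ?D (?l t)"
    unfolding eventually_at_right_field by auto
  define b where "b = min d e / 2"
  have b: "0 < b" "b < d" "b < e" using d(1) e(1) by (auto simp: b_def min_def)
  have "f (?l 0) < f (?l b)"
  \<comment> \<open>At \<open>t = 0\<close> the segment is at \<open>x\<close>, where
    \<open>f\<close> need not be differentiable. So derivatives are taken on the open interval only,
    and continuity on the closure covers the end point.\<close>
  proof (rule DERIV_pos_imp_increasing_open[OF b(1)])
    fix t assume t: "0 < t" "t < b"
    then show "\<exists>y. ((\<lambda>t. f (?l t)) has_real_derivative y) (at t) \<and> 0 < y"
      using has_real_derivative_along_line[OF diff[OF e(2)[of t]]] d(2)[of t] b by fastforce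
  next
    have "?l ` {0..b} \<subseteq> closure S"
    proof (rule image_subsetI)
      fix t assume "t \<in> {0..b}"
      then show "?l t \<in> closure S"
        using e(2)[of t] b xS(1) closure_subset[of S] by (cases "t = 0") auto
    qed
    then show "continuous_on {0..b} (\<lambda>t. f (?l t))"
      by (intro continuous_on_compose2[OF cont]) (auto intro!: continuous_intros)
  qed
  moreover have "f (?l b) \<le> f x"
    using max e(2)[of b] b closure_subset[of S] by blast
  ultimately show False by simp
qed

section \<open>The maximum principle for one equation with self-diffusion\<close>

text \<open>Differentiating twice in direction \<open>i\<close> gives \<open>d + 2 * a * f x\<close>
  times the second partial derivative of \<open>f\<close>, plus \<open>2 * a\<close> times the
  square of the first one. At the maximum the square vanishes and the remaining product is
  nonpositive.\<close>

lemma laplacian_self_diffusion_nonpos_at_max: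
  fixes S :: "(real^'n::finite) set"
  assumes "open S" "x \<in> S" and C2: "Ck_on 2 S f"
    and max: "\<And>y. y \<in> S \<Longrightarrow> f y \<le> f x" and coeff: "0 \<le> d + 2 * a * f x"
  shows "laplacian (\<lambda>y. (d + a * f y) * f y) x \<le> 0"
proof -
  let ?w = "\<lambda>y. (d + a * f y) * f y"
  have C2': "\<And>y. y \<in> S \<Longrightarrow> f differentiable (at y)"
      "\<And>i y. y \<in> S \<Longrightarrow> partial_deriv i f differentiable (at y)"
    using C2 by (auto simp: numeral_2_eq_2)
  have der: "(f has_derivative frechet_derivative f (at y)) (at y)" if "y \<in> S" for y
    using C2'(1)[OF that] frechet_derivative_works by blast
  have "partial_deriv i (partial_deriv i ?w) x \<le> 0" for i
  proof -
    let ?p = "partial_deriv i f"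
    \<comment> \<open>The formula is proved on all of \<open>S\<close>, not just at
      \<open>x\<close>: to be differentiated again it must hold in a neighbourhood.\<close>
    have first: "partial_deriv i ?w y = (d + 2 * a * f y) * ?p y" if "y \<in> S" for y
    proof -
      let ?F = "frechet_derivative f (at y)"
      have "(?w has_derivative (\<lambda>h. (d + 2 * a * f y) * ?F h)) (at y)"
        by (rule derivative_eq_intros der[OF that] refl)+ (simp add: fun_eq_iff algebra_simps)
      then show ?thesis
        by (simp add: partial_deriv_def frechet_derivative_at[symmetric])
    qed
    let ?P = "frechet_derivative ?p (at x)"
    let ?F = "frechet_derivative f (at x)"
    have "(?p has_derivative ?P) (at x)"
      using C2'(2)[OF \<open>x \<in> S\<close>] frechet_derivative_works by blast
    then have "((\<lambda>y. (d + 2 * a * f y) * ?p y) has_derivative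
        (\<lambda>h. (d + 2 * a * f x) * ?P h + 2 * a * ?F h * ?p x)) (at x)"
      by (auto intro!: derivative_eq_intros der[OF \<open>x \<in> S\<close>])
    then have "(partial_deriv i ?w has_derivative
        (\<lambda>h. (d + 2 * a * f x) * ?P h + 2 * a * ?F h * ?p x)) (at x)"
      by (rule has_derivative_transform_within_open[OF _ assms(1,2)]) (simp add: first)
    \<comment> \<open>Only the outer derivatives are unfolded at first, so that the inner
      \<open>partial_deriv i ?w\<close> still matches the derivative just established.\<close>
    then have "partial_deriv i (partial_deriv i ?w) x =
        (d + 2 * a * f x) * partial_deriv i ?p x + 2 * a * ?p x * ?p x"
      by (simp add: partial_deriv_def[of i "partial_deriv i _"] frechet_derivative_at[symmetric])
         (simp add: partial_deriv_def)
    moreover have "?p x = 0"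
      using partial_deriv_eq_0_at_max assms(1,2) C2'(1) max by blast
    moreover have "partial_deriv i ?p x \<le> 0"
      using second_partial_deriv_nonpos_at_max assms(1,2) C2' max by blast
    ultimately show ?thesis
      using coeff by (simp add: mult_nonneg_nonpos)
  qed
  then show ?thesis by (simp add: laplacian_def sum_nonpos)
qed

text \<open>Serves both species: \<open>b\<close> stands for the competition term, which enters only
  through its sign.\<close>

lemma robin_solution_le_1:
  fixes S :: "(real^'n::finite) set"
  assumes "open S" "bounded S"
    and normal: "\<And>x. x \<in> frontier S \<Longrightarrow> outward_unit_normal S x (\<nu> x)"
    and const: "0 < d" "0 \<le> a" "0 < \<alpha>" "0 < \<beta>"
    and C: "C1_closure S u" "Ck_on 2 S u"
    and b: "\<And>x. x \<in> S \<Longrightarrow> 0 \<le> b x"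
    and eq: "\<And>x. x \<in> S \<Longrightarrow> laplacian (\<lambda>y. (d + a * u y) * u y) x + u x * (1 - u x - b x) = 0"
    and robin: "\<And>x. x \<in> frontier S \<Longrightarrow> \<alpha> * u x + \<beta> * normal_deriv S \<nu> u x = 0"
    and z: "z \<in> closure S"
  shows "u z \<le> 1"
proof (rule ccontr)
  assume large: "\<not> ?thesis"
  have "compact (closure S)" using \<open>bounded S\<close> by simp
  moreover have "continuous_on (closure S) u" using C(1) by (simp add: C1_closure_def)
  moreover have "closure S \<noteq> {}" using z by auto
  ultimately obtain x where x: "x \<in> closure S" and max: "\<And>y. y \<in> closure S \<Longrightarrow> u y \<le> u x"
    using continuous_attains_sup by metis
  have gt: "1 < u x" using max[OF z] large by simp
  show False
  proof (cases "x \<in> S")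
    case True
    have "laplacian (\<lambda>y. (d + a * u y) * u y) x \<le> 0"
      using const gt max closure_subset[of S]
      by (intro laplacian_self_diffusion_nonpos_at_max[OF \<open>open S\<close> True C(2)]) auto
    \<comment> \<open>Strictness comes from \<open>u x > 1\<close>; together with the nonpositive
      Laplacian, it contradicts the equation.\<close>
    moreover have "u x * (1 - u x - b x) < 0"
      using gt b[OF True] by (intro mult_pos_neg) auto
    ultimately show False using eq[OF True] by simp
  next
    case False
    then have fr: "x \<in> frontier S"
      using x \<open>open S\<close> by (simp add: frontier_def interior_open)
    \<comment> \<open>Both terms of the Robin condition are now nonnegative and
      \<open>\<alpha> * u x\<close> is positive, so their sum cannot vanish.\<close>
    have "0 \<le> \<beta> * normal_deriv S \<nu> u x"
      using normal_deriv_nonneg_at_max[where \<nu> = \<nu> and f = u, OF \<open>open S\<close> fr normal[OF fr] C(1) max] const by simp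
    moreover have "0 < \<alpha> * u x" using gt const by simp
    ultimately show False using robin[OF fr] by simp
  qed
qed

theorem lemma3p3:
  fixes \<Omega> :: "(real^'n::finite) set" and \<nu> :: "real^'n \<Rightarrow> real^'n"
    and u v :: "real^'n \<Rightarrow> real"
    and a\<^sub>1 a\<^sub>2 d\<^sub>1 d\<^sub>2 a\<^sub>1\<^sub>1 a\<^sub>2\<^sub>2 \<alpha>\<^sub>1 \<alpha>\<^sub>2 \<beta>\<^sub>1 \<beta>\<^sub>2 :: real
  assumes "open \<Omega>" and "connected \<Omega>" and "\<Omega> \<noteq> {}" and "bounded \<Omega>"
    and "smooth_boundary \<Omega>" and "interior_ball_condition \<Omega>"
    and "\<forall>x\<in>frontier \<Omega>. outward_unit_normal \<Omega> x (\<nu> x)"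
    and "a\<^sub>1 > 0" and "a\<^sub>2 > 0" and "d\<^sub>1 > 0" and "d\<^sub>2 > 0" and "a\<^sub>1\<^sub>1 \<ge> 0" and "a\<^sub>2\<^sub>2 \<ge> 0"
    and "\<alpha>\<^sub>1 > 0" and "\<alpha>\<^sub>2 > 0" and "\<beta>\<^sub>1 > 0" and "\<beta>\<^sub>2 > 0"
    and "nonneg_classical_solution \<Omega> \<nu> d\<^sub>1 a\<^sub>1\<^sub>1 a\<^sub>1 d\<^sub>2 a\<^sub>2\<^sub>2 a\<^sub>2 \<alpha>\<^sub>1 \<beta>\<^sub>1 \<alpha>\<^sub>2 \<beta>\<^sub>2 u v"
  shows "((\<exists>x\<in>closure \<Omega>. u x \<noteq> 0) \<longrightarrow> (\<forall>x\<in>closure \<Omega>. u x \<le> 1)) \<and>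
         ((\<exists>x\<in>closure \<Omega>. v x \<noteq> 0) \<longrightarrow> (\<forall>x\<in>closure \<Omega>. v x \<le> 1))"
proof -
  note sol = assms(18)[unfolded nonneg_classical_solution_def]
  have sub: "x \<in> closure \<Omega>" if "x \<in> \<Omega>" for x
    using that closure_subset by blast
  have "u z \<le> 1" if "z \<in> closure \<Omega>" for z
    by (rule robin_solution_le_1[of \<Omega> \<nu> d\<^sub>1 a\<^sub>1\<^sub>1 \<alpha>\<^sub>1 \<beta>\<^sub>1 u "\<lambda>x. a\<^sub>1 * v x"])
       (use sol assms that sub in auto)
  moreover have "v z \<le> 1" if "z \<in> closure \<Omega>" for z
  \<comment> \<open>The roles of the species are exchanged. The second equation lists the
    competition term before \<open>v\<close>, so it is first rearranged into the form used by the
    lemma.\<close>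
  proof (rule robin_solution_le_1[of \<Omega> \<nu> d\<^sub>2 a\<^sub>2\<^sub>2 \<alpha>\<^sub>2 \<beta>\<^sub>2 v "\<lambda>x. a\<^sub>2 * u x"])
    fix x assume "x \<in> \<Omega>"
    then show "laplacian (\<lambda>y. (d\<^sub>2 + a\<^sub>2\<^sub>2 * v y) * v y) x + v x * (1 - v x - a\<^sub>2 * u x) = 0"
      using sol by (simp add: algebra_simps)
  qed (use sol assms that sub in auto)
  ultimately show ?thesis by blast
qed

end
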